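(* Let $\delta\in\mathbb{C}$, let $(N,\cdot,\circ)$ be a $\delta$-Novikov--Poisson algebra over $\mathbb{C}$, let $u\in N$ be a fixed element, and let $\ast$ be the Kantor product of $\cdot$ and $\circ$ with respect to $u$, i.e. $$x\ast y=u\cdot(x\circ y)-(u\cdot x)\circ y-x\circ(u\cdot y).$$ Then $(N,\ast)$ is a $\delta$-Novikov algebra.
   Context: A (left) $\delta$-Novikov algebra is an algebra $(N,\circ)$ satisfying $\delta(x\circ y)\circ z-x\circ(y\circ z)=\delta(y\circ x)\circ z-y\circ(x\circ z)$ and $(x\circ y)\circ z=(x\circ z)\circ y$. A $\delta$-Novikov--Poisson algebra is a vector space $N$ with two bilinear operations $\cdot$ (also written by juxtaposition) and $\circ$ such that $(N,\cdot)$ is a commutative associative algebra, $(N,\circ)$ is a $\delta$-Novikov algebra, and for all $x,y,z\in N$: $(xy)\circ z=x(y\circ z)$ and $\delta(x\circ y)z-x\circ(yz)=\delta(y\circ x)z-y\circ(xz)$. For bilinear multiplications $A,B$ on a vector space and a fixed vector $u$, the Kantor product of $A$ and $B$ is $x\ast y=A(u,B(x,y))-B(A(u,x),y)-B(x,A(u,y))$. *)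

theory Defs
  imports Complex_Main
begin

definition bilinear_mult ::
  "('k::field \<Rightarrow> 'a::ab_group_add \<Rightarrow> 'a) \<Rightarrow> ('a \<Rightarrow> 'a \<Rightarrow> 'a) \<Rightarrow> bool" where
  "bilinear_mult scale m \<longleftrightarrow>
     (\<forall>x. Vector_Spaces.linear scale scale (\<lambda>y. m x y)) \<and>
     (\<forall>y. Vector_Spaces.linear scale scale (\<lambda>x. m x y))"

text \<open>The underlying space of an algebra is the whole type \<open>'a\<close>, with scalar multiplication
  \<open>scale\<close>; algebras are not assumed associative or unital.\<close>

locale algebra_over = vector_space scale
  for scale :: "'k::field \<Rightarrow> 'a::ab_group_add \<Rightarrow> 'a" +
  fixes mult :: "'a \<Rightarrow> 'a \<Rightarrow> 'a"
  assumes bilinear: "bilinear_mult scale mult"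

locale comm_assoc_algebra = algebra_over scale mult
  for scale :: "'k::field \<Rightarrow> 'a::ab_group_add \<Rightarrow> 'a"
    and mult :: "'a \<Rightarrow> 'a \<Rightarrow> 'a" +
  assumes mult_assoc: "mult (mult x y) z = mult x (mult y z)"
    and mult_commute: "mult x y = mult y x"

locale delta_novikov_algebra = algebra_over scale circ
  for scale :: "'k::field \<Rightarrow> 'a::ab_group_add \<Rightarrow> 'a"
    and \<delta> :: 'k
    and circ :: "'a \<Rightarrow> 'a \<Rightarrow> 'a" +
  assumes left_symmetric:
      "scale \<delta> (circ (circ x y) z) - circ x (circ y z) =
       scale \<delta> (circ (circ y x) z) - circ y (circ x z)"
    and right_commute: "circ (circ x y) z = circ (circ x z) y"

locale delta_novikov_poisson_algebra =
  comm_assoc_algebra scale dot + delta_novikov_algebra scale \<delta> circ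
  for scale :: "'k::field \<Rightarrow> 'a::ab_group_add \<Rightarrow> 'a"
    and \<delta> :: 'k
    and dot :: "'a \<Rightarrow> 'a \<Rightarrow> 'a"
    and circ :: "'a \<Rightarrow> 'a \<Rightarrow> 'a" +
  assumes dot_circ: "circ (dot x y) z = dot x (circ y z)"
    and circ_dot_symmetric:
      "scale \<delta> (dot (circ x y) z) - circ x (dot y z) =
       scale \<delta> (dot (circ y x) z) - circ y (dot x z)"

definition kantor_product ::
  "('a::ab_group_add \<Rightarrow> 'a \<Rightarrow> 'a) \<Rightarrow> ('a \<Rightarrow> 'a \<Rightarrow> 'a) \<Rightarrow> 'a \<Rightarrow> 'a \<Rightarrow> 'a \<Rightarrow> 'a" where
  "kantor_product A B u x y = A u (B x y) - B (A u x) y - B x (A u y)"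

end

theory Submission
  imports Defs
begin

text \<open>
  Since \<open>u(x \<circ> y) = (ux) \<circ> y\<close>, the first two terms of the Kantor product cancel and
  \<open>x \<ast> y = -(x \<circ> (uy))\<close>: up to sign, the new product is the old one with its right factor
  multiplied by \<open>u\<close>.  Right commutativity of \<open>\<ast>\<close> is then right commutativity of \<open>\<circ>\<close>, applied
  to right multiplication by \<open>uy\<close> and by \<open>uz\<close>.

  Write \<open>(x, y, z) = \<delta>(x \<circ> y) \<circ> z - x \<circ> (y \<circ> z)\<close> for the \<open>\<delta>\<close>-associator, which is symmetric in
  \<open>x\<close> and \<open>y\<close>.  It is linear over the commutative algebra in its first argument, because
  \<open>\<circ>\<close> is so in its left factor; by symmetry the same holds in the second argument.  The
  \<open>\<delta>\<close>-associator of \<open>\<ast>\<close> is \<open>(x, uy, uz) = u(x, y, uz)\<close>, so its symmetry in \<open>x\<close> and \<open>y\<close>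
  is inherited from \<open>\<circ>\<close>.
\<close>

lemma bilinear_mult_neg_compose_right:
  assumes "bilinear_mult scale m" and f: "Vector_Spaces.linear scale scale f"
  shows "bilinear_mult scale (\<lambda>x y. - m x (f y))"
proof -
  have right: "Vector_Spaces.linear scale scale (m x)"
    and left: "Vector_Spaces.linear scale scale (\<lambda>x. m x y)" for x y
    using assms(1) by (simp_all add: bilinear_mult_def)
  interpret vector_space scale
    using f by (simp add: Vector_Spaces.linear_iff)
  show ?thesis
    using right left f
    by (simp add: bilinear_mult_def Vector_Spaces.linear_iff scale_minus_right)
qed

context delta_novikov_poisson_algebra
begin

text \<open>The terms \<open>u(x \<circ> y)\<close> and \<open>(ux) \<circ> y\<close> cancel because multiplication by \<open>u\<close> passes through
  the left factor of \<open>\<circ>\<close>.\<close>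

lemma kantor_product_eq: "kantor_product dot circ u x y = - circ x (dot u y)"
  by (simp add: kantor_product_def dot_circ)

lemma bilinear_dot: "bilinear_mult scale dot"
  using algebra_over.bilinear comm_assoc_algebra.axioms(1) comm_assoc_algebra_axioms by blast

lemma bilinear_circ: "bilinear_mult scale circ"
  using algebra_over.bilinear delta_novikov_algebra.axioms(1) delta_novikov_algebra_axioms
  by blast

lemma module_hom_dot_right: "module_hom scale scale (dot a)"
  using bilinear_dot by (simp add: bilinear_mult_def linear_iff_module_hom)

lemma circ_minus_left: "circ (- x) y = - circ x y"
proof -
  have "module_hom scale scale (\<lambda>x. circ x y)"
    using bilinear_circ by (simp add: bilinear_mult_def linear_iff_module_hom)
  then show ?thesis
    by (rule module_hom.neg)
qed

lemma circ_minus_right: "circ x (- y) = - circ x y"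
proof -
  have "module_hom scale scale (circ x)"
    using bilinear_circ by (simp add: bilinear_mult_def linear_iff_module_hom)
  then show ?thesis
    by (rule module_hom.neg)
qed

lemma dot_minus_right: "dot x (- y) = - dot x y"
  using module_hom_dot_right by (rule module_hom.neg)

definition delta_associator :: "'a \<Rightarrow> 'a \<Rightarrow> 'a \<Rightarrow> 'a" where
  "delta_associator x y z = scale \<delta> (circ (circ x y) z) - circ x (circ y z)"

lemma delta_associator_commute: "delta_associator x y z = delta_associator y x z"
  unfolding delta_associator_def by (rule left_symmetric)

lemma delta_associator_dot_left:
  "delta_associator (dot a x) y z = dot a (delta_associator x y z)"
  using module_hom_dot_right[of a]
  by (simp add: delta_associator_def dot_circ module_hom.diff module_hom.scale)

text \<open>The factor \<open>a\<close> leaves the first argument because it leaves the left factor of each \<open>\<circ>\<close>; the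
  symmetry of the \<open>\<delta>\<close>-associator carries this over to the second argument, although \<open>\<circ>\<close> itself
  need not be linear over \<open>\<cdot>\<close> in its right factor.\<close>

lemma delta_associator_dot_middle:
  "delta_associator x (dot a y) z = dot a (delta_associator x y z)"
  by (metis delta_associator_commute delta_associator_dot_left)

text \<open>The two signs in each iterated product cancel, and \<open>u(y \<circ> (uz)) = (uy) \<circ> (uz)\<close> turns the left side
  into the \<open>\<delta>\<close>-associator of \<open>x\<close>, \<open>uy\<close> and \<open>uz\<close>; taking \<open>u\<close> out of the second argument makes the
  symmetry in \<open>x\<close> and \<open>y\<close> visible.\<close>

lemma kantor_product_delta_associator:
  "scale \<delta> (kantor_product dot circ u (kantor_product dot circ u x y) z)
     - kantor_product dot circ u x (kantor_product dot circ u y z)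
   = dot u (delta_associator x y (dot u z))"
proof -
  have "scale \<delta> (kantor_product dot circ u (kantor_product dot circ u x y) z)
      - kantor_product dot circ u x (kantor_product dot circ u y z)
    = delta_associator x (dot u y) (dot u z)"
    by (simp add: kantor_product_eq circ_minus_left circ_minus_right dot_minus_right
        delta_associator_def dot_circ)
  then show ?thesis
    by (simp add: delta_associator_dot_middle)
qed

end

theorem theorem26:
  fixes scale :: "complex \<Rightarrow> 'a::ab_group_add \<Rightarrow> 'a"
    and \<delta> :: complex
    and dot circ :: "'a \<Rightarrow> 'a \<Rightarrow> 'a"
    and u :: 'a
  assumes "delta_novikov_poisson_algebra scale \<delta> dot circ"
  shows "delta_novikov_algebra scale \<delta> (kantor_product dot circ u)"
proof -
  interpret delta_novikov_poisson_algebra scale \<delta> dot circ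
    by (rule assms)
  have "Vector_Spaces.linear scale scale (dot u)"
    using bilinear_dot by (simp add: bilinear_mult_def)
  then have "bilinear_mult scale (\<lambda>x y. - circ x (dot u y))"
    by (rule bilinear_mult_neg_compose_right[OF bilinear_circ])
  moreover have "kantor_product dot circ u = (\<lambda>x y. - circ x (dot u y))"
    by (simp add: fun_eq_iff kantor_product_eq)
  ultimately have kantor_bilinear: "bilinear_mult scale (kantor_product dot circ u)"
    by simp
  show ?thesis
  proof
    fix x y z
    show "bilinear_mult scale (kantor_product dot circ u)"
      by (rule kantor_bilinear)
    show "scale \<delta> (kantor_product dot circ u (kantor_product dot circ u x y) z)
        - kantor_product dot circ u x (kantor_product dot circ u y z)
      = scale \<delta> (kantor_product dot circ u (kantor_product dot circ u y x) z)
        - kantor_product dot circ u y (kantor_product dot circ u x z)"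
      by (simp add: kantor_product_delta_associator delta_associator_commute[of x y])
    show "kantor_product dot circ u (kantor_product dot circ u x y) z
      = kantor_product dot circ u (kantor_product dot circ u x z) y"
      by (simp add: kantor_product_eq circ_minus_left right_commute[of x "dot u y"])
  qed
qed

end
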